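(* Let $\delta_{3k,3s}<0.5$ be the RIP constant of $\mathbf{A}$ for the set $\mathcal{M}_{3k,3s}$. Let $X^*$ be the (unique) solution of $$\mathbf{A}(X)=y,\quad X\in\mathcal{M}_{k,s},$$ and suppose $X^*$ has exactly $s$ nonzero rows. Assume $X_0\in\mathcal{M}_{k,s}$ satisfies $$\|X_0-X^*\|_F\le\frac{\mu}{2\|\mathbf{I}-\mathbf{A}^*\mathbf{A}\|},$$ where $\mu$ is the smallest Euclidean norm among the nonzero rows of $X^*$. Then the sequence generated from $X_0$ by the iteration $$X_{\ell+1}=(\mathbf{T}_k\circ\mathbf{H}_s)\bigl(X_\ell-\mathbf{A}^*(\mathbf{A}(X_\ell)-y)\bigr),\qquad \ell=0,1,\dots,$$ satisfies $$\|X_{\ell+1}-X^*\|_F\le2\delta_{3k,3s}\,\|X_\ell-X^*\|_F\quad\text{for all }\ell\ge0.$$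
   Context: $M,N,m,k,s$ are positive integers with $k<s$. $\mathbf{A}:\mathbb{R}^{M\times N}\to\mathbb{R}^m$ is a linear operator, $\mathbf{A}^*$ its adjoint with respect to the Frobenius and Euclidean inner products, $y\in\mathbb{R}^m$, $\mathbf{I}$ is the identity on $\mathbb{R}^{M\times N}$, and $\|\mathbf{I}-\mathbf{A}^*\mathbf{A}\|$ is the operator (spectral) norm on $\mathbb{R}^{M\times N}$ equipped with the Frobenius norm. $\|X\|_0$ denotes the number of nonzero rows of $X$, and for integers $k,s$, $\mathcal{M}_{k,s}=\{X\in\mathbb{R}^{M\times N}:\operatorname{rank}(X)\le k,\ \|X\|_0\le s\}$. $\mathbf{A}$ satisfies a $\delta_{k,s}$-RIP on $\mathcal{M}_{k,s}$ if $(1-\delta_{k,s})\|X\|_F^2\le\|\mathbf{A}(X)\|^2\le(1+\delta_{k,s})\|X\|_F^2$ for all $X\in\mathcal{M}_{k,s}$; $\delta_{3k,3s}$ is such a constant for the set $\mathcal{M}_{3k,3s}$. $\mathbf{H}_s(X)=X_S$, where $S\subseteq\{1,\dots,M\}$ contains the indices of $s$ rows of $X$ with largest Euclidean norm, and $X_S$ denotes $X$ with all rows not in $S$ set to zero. $\mathbf{T}_k(X)$ is a best approximation of $X$ in Frobenius norm by matrices of rank at most $k$. If these are not unique, some specific (arbitrary) selection rule is applied. The iteration is iterative hard thresholding with quasi-optimal projection and fixed step size $1$. *)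

theory Defs
  imports "HOL-Analysis.Analysis"
begin

text \<open>
  The type \<open>real^'c^'r\<close> consists of the matrices with rows indexed by \<open>'r\<close> and columns
  indexed by \<open>'c\<close>. Its library norm is the Euclidean norm of the vector of Euclidean row norms,
  i.e. the Frobenius norm, and likewise its inner product is the Frobenius inner product; hence
  \<open>adjoint\<close> and \<open>onorm\<close> for maps from this type refer to the Frobenius structure.
\<close>

definition nonzero_rows :: "real^'c^'r \<Rightarrow> 'r set"
  where "nonzero_rows X = {i. row i X \<noteq> 0}"

definition rank_row_sparse :: "nat \<Rightarrow> nat \<Rightarrow> (real^'c^'r) set"
  where "rank_row_sparse k s = {X. rank X \<le> k \<and> card (nonzero_rows X) \<le> s}"

definition RIP :: "(real^'c^'r \<Rightarrow> real^'m) \<Rightarrow> real \<Rightarrow> (real^'c^'r) set \<Rightarrow> bool"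
  where "RIP A \<delta> \<M> \<longleftrightarrow>
    (\<forall>X\<in>\<M>. (1 - \<delta>) * (norm X)\<^sup>2 \<le> (norm (A X))\<^sup>2 \<and> (norm (A X))\<^sup>2 \<le> (1 + \<delta>) * (norm X)\<^sup>2)"

definition restrict_rows :: "'r set \<Rightarrow> real^'c^'r \<Rightarrow> real^'c^'r"
  where "restrict_rows S X = (\<chi> i. if i \<in> S then X $ i else 0)"

definition largest_rows :: "nat \<Rightarrow> real^'c^'r \<Rightarrow> 'r set \<Rightarrow> bool"
  where "largest_rows s X S \<longleftrightarrow>
    card S = s \<and> (\<forall>i\<in>S. \<forall>j. j \<notin> S \<longrightarrow> norm (row j X) \<le> norm (row i X))"

text \<open>
  The two operators are determined only up to the choice among ties. The predicates below
  hold of every operator obtained from some selection rule.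
\<close>

definition row_hard_thresholding :: "nat \<Rightarrow> (real^'c^'r \<Rightarrow> real^'c^'r) \<Rightarrow> bool"
  where "row_hard_thresholding s H \<longleftrightarrow>
    (\<forall>X. \<exists>S. largest_rows s X S \<and> H X = restrict_rows S X)"

definition best_rank_approximation :: "nat \<Rightarrow> (real^'c^'r \<Rightarrow> real^'c^'r) \<Rightarrow> bool"
  where "best_rank_approximation k T \<longleftrightarrow>
    (\<forall>X. rank (T X) \<le> k \<and> (\<forall>Z. rank Z \<le> k \<longrightarrow> norm (X - T X) \<le> norm (X - Z)))"

definition min_nonzero_row_norm :: "real^'c^'r \<Rightarrow> real"
  where "min_nonzero_row_norm X = Min ((\<lambda>i. norm (row i X)) ` nonzero_rows X)"

end

theory Submission imports Defs begin

text \<open>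
  Write \<open>V\<close> for the gradient step taken from an iterate \<open>X\<close>. Since \<open>A Xstar = y\<close>, the error
  obeys \<open>V - Xstar = (I - A\<^sup>* A) (X - Xstar)\<close>, so the bound on the initial error puts \<open>V\<close> within
  half of the smallest nonzero row norm of \<open>Xstar\<close>. At that distance no zero row of \<open>Xstar\<close> can
  have grown as large as a nonzero one has shrunk, and as \<open>Xstar\<close> has exactly \<open>s\<close> nonzero rows,
  row thresholding is forced to keep precisely these
  (\<open>largest_rows_eq_nonzero_rows\<close>).

  Once the support \<open>S\<close> is right, the composition of the two quasi-optimal steps is as good as an
  exact projection: the best rank \<open>k\<close> approximation of a matrix supported on \<open>S\<close> is itself
  supported on \<open>S\<close> (\<open>best_rank_approximation_supported\<close>), hence its error \<open>D\<close> is orthogonal to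
  everything that thresholding has removed. Comparing it with the competitor \<open>Xstar\<close> yields
  \<open>\<parallel>D\<parallel>\<^sup>2 \<le> 2 \<langle>D, V - Xstar\<rangle>\<close>. With \<open>E = X - Xstar\<close> the inner product equals
  \<open>\<langle>D, E\<rangle> - \<langle>A D, A E\<rangle>\<close>. All combinations of \<open>D\<close> and \<open>E\<close> are combinations of three elements of
  \<open>\<M>\<^sub>k\<^sub>,\<^sub>s\<close>, so the RIP, polarized, bounds this by \<open>\<delta> \<parallel>D\<parallel> \<parallel>E\<parallel>\<close>
  (\<open>RIP_polarization\<close>). Cancelling \<open>\<parallel>D\<parallel>\<close> leaves the contraction factor \<open>2 \<delta> < 1\<close>, so the error
  does not leave the initial radius and the argument can be repeated.
\<close>

section \<open>Row supports and Frobenius geometry\<close>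

lemma row_eq_nth: "row i X = X $ i"
  by (simp add: row_def vec_eq_iff)

lemma norm_square_vec: "(norm X)\<^sup>2 = (\<Sum>i\<in>UNIV. (norm (X $ i))\<^sup>2)" for X :: "'a::real_normed_vector^'r"
  by (simp add: norm_vec_def L2_set_def sum_nonneg)

lemma nonzero_rows_empty_iff: "nonzero_rows X = {} \<longleftrightarrow> X = 0"
  by (auto simp: nonzero_rows_def row_eq_nth vec_eq_iff)

lemma min_nonzero_row_norm_le:
  assumes "i \<in> nonzero_rows X"
  shows "min_nonzero_row_norm X \<le> norm (X $ i)"
  using assms by (auto simp: min_nonzero_row_norm_def row_eq_nth[symmetric] intro!: Min_le)

lemma min_nonzero_row_norm_pos:
  assumes "X \<noteq> 0"
  shows "0 < min_nonzero_row_norm X"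
proof -
  have "nonzero_rows X \<noteq> {}"
    using assms by (simp add: nonzero_rows_empty_iff)
  then show ?thesis
    unfolding min_nonzero_row_norm_def
    by (subst Min_gr_iff) (auto simp: nonzero_rows_def)
qed

lemma restrict_rows_diff: "restrict_rows S (X - Y) = restrict_rows S X - restrict_rows S Y"
  by (simp add: restrict_rows_def vec_eq_iff)

lemma inner_restrict_rows: "restrict_rows S X \<bullet> Y = X \<bullet> restrict_rows S Y"
  unfolding inner_vec_def[of "restrict_rows S X"] inner_vec_def[of X]
  by (intro sum.cong refl) (simp add: restrict_rows_def)

lemma restrict_rows_idem: "restrict_rows S (restrict_rows S X) = restrict_rows S X"
  by (simp add: restrict_rows_def vec_eq_iff)

lemma restrict_rows_eq_iff: "restrict_rows S X = X \<longleftrightarrow> nonzero_rows X \<subseteq> S"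
  by (auto simp: restrict_rows_def nonzero_rows_def row_eq_nth vec_eq_iff)

lemma nonzero_rows_restrict_rows: "nonzero_rows (restrict_rows S X) \<subseteq> S"
  by (auto simp: restrict_rows_def nonzero_rows_def row_eq_nth)

lemma norm_square_restrict_rows:
  "(norm X)\<^sup>2 = (norm (restrict_rows S X))\<^sup>2 + (norm (X - restrict_rows S X))\<^sup>2"
proof -
  have "restrict_rows S X \<bullet> restrict_rows S X = restrict_rows S X \<bullet> X"
    using inner_restrict_rows[of S "restrict_rows S X" X] by (simp add: restrict_rows_idem)
  then show ?thesis
    by (simp add: power2_norm_eq_inner inner_diff inner_commute)
qed

lemma rank_restrict_rows_le: "rank (restrict_rows S X) \<le> rank X"
proof -
  have "restrict_rows S X = (\<chi> i j. if i = j \<and> i \<in> S then 1 else 0) ** X"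
    by (auto simp: restrict_rows_def matrix_matrix_mult_def vec_eq_iff if_distrib[where f="\<lambda>x. x * _"]
        sum.delta cong: if_cong)
  then show ?thesis
    by (simp only: rank_mul_le_right)
qed

section \<open>Combinations of row-sparse low-rank matrices\<close>

lemma rank_add_le: "rank (X + Y) \<le> rank X + rank Y" for X Y :: "real^'c^'r"
proof -
  let ?U = "range ((*v) X)" and ?W = "range ((*v) Y)"
  have "range ((*v) (X + Y)) \<subseteq> {u + w | u w. u \<in> ?U \<and> w \<in> ?W}"
    by (auto simp: matrix_vector_mult_add_rdistrib)
  then have "dim (range ((*v) (X + Y))) \<le> dim {u + w | u w. u \<in> ?U \<and> w \<in> ?W}"
    by (rule dim_subset)
  also have "\<dots> \<le> dim ?U + dim ?W"
    using dim_sums_Int[of ?U ?W]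
    by (simp add: subspace_UNIV linear_subspace_image)
  finally show ?thesis
    by (simp add: rank_dim_range)
qed

lemma rank_scaleR_le: "rank (a *\<^sub>R X) \<le> rank X" for X :: "real^'c^'r"
proof -
  have "a *\<^sub>R X = (a *\<^sub>R mat 1) ** X"
    by (simp add: scalar_matrix_assoc[symmetric])
  then show ?thesis
    by (simp only: rank_mul_le_right)
qed

lemma rank_row_sparse_add:
  assumes "X \<in> rank_row_sparse k s" and "Y \<in> rank_row_sparse l t"
  shows "X + Y \<in> rank_row_sparse (k + l) (s + t)"
proof -
  have "nonzero_rows (X + Y) \<subseteq> nonzero_rows X \<union> nonzero_rows Y"
    by (auto simp: nonzero_rows_def row_eq_nth)
  then have "card (nonzero_rows (X + Y)) \<le> card (nonzero_rows X) + card (nonzero_rows Y)"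
    by (meson card_Un_le card_mono finite le_trans)
  then show ?thesis
    using assms rank_add_le[of X Y] by (auto simp: rank_row_sparse_def)
qed

lemma rank_row_sparse_scaleR:
  assumes "X \<in> rank_row_sparse k s"
  shows "a *\<^sub>R X \<in> rank_row_sparse k s"
proof -
  have "nonzero_rows (a *\<^sub>R X) \<subseteq> nonzero_rows X"
    by (auto simp: nonzero_rows_def row_eq_nth)
  then have "card (nonzero_rows (a *\<^sub>R X)) \<le> card (nonzero_rows X)"
    by (simp add: card_mono)
  then show ?thesis
    using assms rank_scaleR_le[of a X] by (auto simp: rank_row_sparse_def)
qed

text \<open>
  The two differences share the matrix \<open>Z\<close>, which is why three times the rank and sparsity is
  enough and not four times.
\<close>

lemma rank_row_sparse_combination_diffs:
  assumes "X \<in> rank_row_sparse k s" "Y \<in> rank_row_sparse k s" "Z \<in> rank_row_sparse k s"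
  shows "a *\<^sub>R (X - Z) + b *\<^sub>R (Y - Z) \<in> rank_row_sparse (3 * k) (3 * s)"
proof -
  have "a *\<^sub>R (X - Z) + b *\<^sub>R (Y - Z) = a *\<^sub>R X + b *\<^sub>R Y + (- a - b) *\<^sub>R Z"
    by (simp add: algebra_simps)
  moreover have "a *\<^sub>R X + b *\<^sub>R Y + (- a - b) *\<^sub>R Z \<in> rank_row_sparse (k + k + k) (s + s + s)"
    using assms by (intro rank_row_sparse_add rank_row_sparse_scaleR)
  moreover have "k + k + k = 3 * k" "s + s + s = 3 * s"
    by simp_all
  ultimately show ?thesis
    by simp
qed

text \<open>
  On normalized matrices \<open>U\<close> and \<open>W\<close> the upper RIP bound for \<open>U - W\<close> and the lower one for
  \<open>U + W\<close> combine through the polarization identity, and \<open>\<parallel>U + W\<parallel>\<^sup>2 + \<parallel>U - W\<parallel>\<^sup>2 = 4\<close> turns the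
  two deviations into a single \<open>\<delta>\<close>. Normalizing is what makes the bound a product of norms.
\<close>

lemma RIP_polarization:
  assumes "linear A" and rip: "RIP A \<delta> \<M>"
    and comb: "\<And>a b. a *\<^sub>R D + b *\<^sub>R E \<in> \<M>"
  shows "D \<bullet> E - A D \<bullet> A E \<le> \<delta> * norm D * norm E"
proof (cases "D = 0 \<or> E = 0")
  case True
  then show ?thesis
    using \<open>linear A\<close> by (auto simp: linear_0)
next
  case False
  define U where "U = D /\<^sub>R norm D"
  define W where "W = E /\<^sub>R norm E"
  have unit: "norm U = 1" "norm W = 1"
    using False by (simp_all add: U_def W_def)
  then have inner1: "U \<bullet> U = 1" "W \<bullet> W = 1"
    by (simp_all add: dot_square_norm)
  have "U + W \<in> \<M>"
    using comb[of "inverse (norm D)" "inverse (norm E)"] by (simp add: U_def W_def)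
  then have lower: "(1 - \<delta>) * (norm (U + W))\<^sup>2 \<le> (norm (A (U + W)))\<^sup>2"
    using rip by (simp add: RIP_def)
  have "U - W \<in> \<M>"
    using comb[of "inverse (norm D)" "- inverse (norm E)"] by (simp add: U_def W_def)
  then have upper: "(norm (A (U - W)))\<^sup>2 \<le> (1 + \<delta>) * (norm (U - W))\<^sup>2"
    using rip by (simp add: RIP_def)
  have sq: "(norm (U + W))\<^sup>2 = 2 + 2 * (U \<bullet> W)" "(norm (U - W))\<^sup>2 = 2 - 2 * (U \<bullet> W)"
    by (simp_all add: power2_norm_eq_inner inner_add inner_diff inner_commute inner1)
  have "(norm (A (U + W)))\<^sup>2 - (norm (A (U - W)))\<^sup>2 = 4 * (A U \<bullet> A W)"
    using \<open>linear A\<close>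
    by (simp add: power2_norm_eq_inner linear_add linear_diff inner_add inner_diff inner_commute)
  moreover have "(1 - \<delta>) * (2 + 2 * (U \<bullet> W)) - (1 + \<delta>) * (2 - 2 * (U \<bullet> W))
      = 4 * (U \<bullet> W) - 4 * \<delta>"
    by (simp add: algebra_simps)
  ultimately have "U \<bullet> W - A U \<bullet> A W \<le> \<delta>"
    using lower upper unfolding sq by linarith
  then have "(norm D * norm E) * (U \<bullet> W - A U \<bullet> A W) \<le> (norm D * norm E) * \<delta>"
    by (rule mult_left_mono) simp
  moreover have "(norm D * norm E) * (U \<bullet> W - A U \<bullet> A W) = D \<bullet> E - A D \<bullet> A E"
    using False by (simp add: U_def W_def linear_scale[OF \<open>linear A\<close>] field_simps)
  ultimately show ?thesis
    by (simp add: algebra_simps)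
qed

section \<open>Support identification and quasi-optimal projection\<close>

text \<open>
  A wrong choice would swap a nonzero row \<open>i\<close> of \<open>Z\<close> for a zero row \<open>j\<close>, and then the
  perturbations of these two rows add up to at least the smallest nonzero row norm, hence to at
  least \<open>2 \<parallel>V - Z\<parallel>\<close>. But they are orthogonal parts of \<open>V - Z\<close>, so their sum is at most
  \<open>\<surd>2 \<parallel>V - Z\<parallel>\<close>. This leaves only \<open>V = Z\<close>, where the zero row \<open>j\<close> cannot beat row \<open>i\<close>.
\<close>

lemma largest_rows_eq_nonzero_rows:
  fixes V Z :: "real^'c^'r"
  assumes card: "card (nonzero_rows Z) = s"
    and near: "2 * norm (V - Z) \<le> min_nonzero_row_norm Z"
    and "largest_rows s V S"
  shows "S = nonzero_rows Z"
proof (rule ccontr)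
  assume ne: "S \<noteq> nonzero_rows Z"
  have cardS: "card S = s"
    and large: "\<And>i j. i \<in> S \<Longrightarrow> j \<notin> S \<Longrightarrow> norm (V $ j) \<le> norm (V $ i)"
    using assms(3) by (auto simp: largest_rows_def row_eq_nth)
  have "\<not> nonzero_rows Z \<subseteq> S" "\<not> S \<subseteq> nonzero_rows Z"
    using ne card cardS by (metis card_subset_eq finite)+
  then obtain i j where i: "i \<in> nonzero_rows Z" "i \<notin> S" and j: "j \<in> S" "j \<notin> nonzero_rows Z"
    by blast
  define ei where "ei = norm ((V - Z) $ i)"
  define ej where "ej = norm ((V - Z) $ j)"
  have "norm (Z $ i) \<le> norm (V $ i) + ei"
    unfolding ei_def by (metis norm_triangle_sub norm_minus_commute vector_minus_component)
  moreover have "norm (V $ i) \<le> ej"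
    using large[OF j(1) i(2)] j(2) by (simp add: ej_def nonzero_rows_def row_eq_nth)
  ultimately have row_bound: "norm (Z $ i) \<le> ei + ej"
    by linarith
  have "(\<Sum>l\<in>{i, j}. (norm ((V - Z) $ l))\<^sup>2) \<le> (norm (V - Z))\<^sup>2"
    unfolding norm_square_vec[of "V - Z"] by (rule sum_mono2) auto
  moreover have "i \<noteq> j"
    using i j by blast
  ultimately have squares: "ei\<^sup>2 + ej\<^sup>2 \<le> (norm (V - Z))\<^sup>2"
    by (simp add: ei_def ej_def)
  have "2 * norm (V - Z) \<le> ei + ej"
    using near min_nonzero_row_norm_le[OF i(1)] row_bound by linarith
  then have "(2 * norm (V - Z))\<^sup>2 \<le> (ei + ej)\<^sup>2"
    by (intro power_mono) auto
  also have "\<dots> \<le> 2 * (ei\<^sup>2 + ej\<^sup>2)"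
    using zero_le_power2[of "ei - ej"] by (simp add: power2_eq_square algebra_simps)
  also have "\<dots> \<le> 2 * (norm (V - Z))\<^sup>2"
    using squares by simp
  finally have "4 * (norm (V - Z))\<^sup>2 \<le> 2 * (norm (V - Z))\<^sup>2"
    by (simp add: power_mult_distrib)
  then have "norm (V - Z) = 0"
    by simp
  then have "norm (Z $ i) \<le> 0"
    using row_bound by (simp add: ei_def ej_def)
  then show False
    using i(1) by (simp add: nonzero_rows_def row_eq_nth)
qed

text \<open>
  Deleting the rows outside \<open>S\<close> does not increase the rank, and by Pythagoras it lowers the
  distance to \<open>W\<close> unless those rows vanish already.
\<close>

lemma best_rank_approximation_supported:
  assumes "best_rank_approximation k T" and supp: "nonzero_rows W \<subseteq> S"
  shows "nonzero_rows (T W) \<subseteq> S"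
proof -
  let ?P = "restrict_rows S"
  have PW: "?P W = W"
    using supp by (simp add: restrict_rows_eq_iff)
  have "rank (?P (T W)) \<le> k"
    using assms(1) rank_restrict_rows_le[of S "T W"]
    by (meson best_rank_approximation_def le_trans)
  then have "norm (W - T W) \<le> norm (W - ?P (T W))"
    using assms(1) by (simp add: best_rank_approximation_def)
  then have "(norm (W - T W))\<^sup>2 \<le> (norm (W - ?P (T W)))\<^sup>2"
    by (intro power_mono) auto
  moreover have "(norm (W - T W))\<^sup>2 = (norm (W - ?P (T W)))\<^sup>2 + (norm (?P (T W) - T W))\<^sup>2"
    using norm_square_restrict_rows[of "W - T W" S] by (simp add: restrict_rows_diff PW)
  ultimately have "?P (T W) = T W"
    by simp
  then show ?thesis
    by (simp add: restrict_rows_eq_iff)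
qed

text \<open>
  This is the only trace that optimality of the projection leaves in the convergence argument.
  The removed rows \<open>V - V\<^sub>S\<close> are orthogonal to the error, so \<open>V\<close> itself may stand
  on the right although \<open>T\<close> is applied to \<open>V\<^sub>S\<close>.
\<close>

lemma quasi_optimal_projection_error:
  fixes V Z :: "real^'c^'r"
  assumes "best_rank_approximation k T" and "rank Z \<le> k" and supp: "nonzero_rows Z \<subseteq> S"
  defines "Y \<equiv> T (restrict_rows S V)"
  shows "(norm (Y - Z))\<^sup>2 \<le> 2 * ((Y - Z) \<bullet> (V - Z))"
proof -
  let ?P = "restrict_rows S"
  have "nonzero_rows (?P V) \<subseteq> S"
    by (rule nonzero_rows_restrict_rows)
  then have "nonzero_rows Y \<subseteq> S"
    unfolding Y_def by (rule best_rank_approximation_supported[OF assms(1)])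
  then have "?P Y = Y"
    by (simp add: restrict_rows_eq_iff)
  moreover have PZ: "?P Z = Z"
    using supp by (simp add: restrict_rows_eq_iff)
  ultimately have "?P (Y - Z) = Y - Z"
    by (simp add: restrict_rows_diff)
  then have "(Y - Z) \<bullet> (V - Z) = (Y - Z) \<bullet> (?P V - Z)"
    using inner_restrict_rows[of S "Y - Z" "V - Z"] by (simp add: restrict_rows_diff PZ)
  moreover have "norm (?P V - Y) \<le> norm (?P V - Z)"
    using assms(1,2) unfolding Y_def best_rank_approximation_def by blast
  then have "(norm (?P V - Y))\<^sup>2 \<le> (norm (?P V - Z))\<^sup>2"
    by (intro power_mono) auto
  moreover have "(norm (?P V - Y))\<^sup>2
      = (norm (?P V - Z))\<^sup>2 - 2 * ((Y - Z) \<bullet> (?P V - Z)) + (norm (Y - Z))\<^sup>2"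
    using dot_norm_neg[of "?P V - Z" "Y - Z"] by (simp add: inner_commute)
  ultimately show ?thesis
    by linarith
qed

section \<open>Contraction of the iteration\<close>

text \<open>
  Membership of the new iterate in \<open>\<M>\<^sub>k\<^sub>,\<^sub>s\<close> is part of the conclusion because the RIP can be used in
  the following step only if the next error is again a difference of such matrices.
\<close>

lemma iterative_hard_thresholding_step:
  fixes A :: "real^'c^'r \<Rightarrow> real^'m"
  assumes lin: "linear A"
    and rip: "RIP A \<delta> (rank_row_sparse (3 * k) (3 * s))"
    and Z: "rank Z \<le> k" "card (nonzero_rows Z) = s"
    and "row_hard_thresholding s H" and T: "best_rank_approximation k T"
    and X: "X \<in> rank_row_sparse k s"
  defines "V \<equiv> X - adjoint A (A X - A Z)"
  assumes near: "2 * norm (V - Z) \<le> min_nonzero_row_norm Z"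
  shows "T (H V) \<in> rank_row_sparse k s"
    and "norm (T (H V) - Z) \<le> 2 * \<delta> * norm (X - Z)"
proof -
  let ?S = "nonzero_rows Z"
  obtain S where "largest_rows s V S" "H V = restrict_rows S V"
    using assms(5) by (auto simp: row_hard_thresholding_def)
  then have HV: "H V = restrict_rows ?S V"
    using largest_rows_eq_nonzero_rows[OF Z(2) near] by simp
  have "nonzero_rows (H V) \<subseteq> ?S"
    by (simp add: HV nonzero_rows_restrict_rows)
  then have "nonzero_rows (T (H V)) \<subseteq> ?S"
    by (rule best_rank_approximation_supported[OF T])
  then have "card (nonzero_rows (T (H V))) \<le> s"
    using Z(2) by (metis card_mono finite)
  then show mem: "T (H V) \<in> rank_row_sparse k s"
    using T by (simp add: rank_row_sparse_def best_rank_approximation_def)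
  define D where "D = T (H V) - Z"
  define E where "E = X - Z"
  have comb: "a *\<^sub>R D + b *\<^sub>R E \<in> rank_row_sparse (3 * k) (3 * s)" for a b
    unfolding D_def E_def
    using mem X Z by (intro rank_row_sparse_combination_diffs) (auto simp: rank_row_sparse_def)
  then have polar: "D \<bullet> E - A D \<bullet> A E \<le> \<delta> * norm D * norm E"
    by (intro RIP_polarization[OF lin rip] comb)
  have "V - Z = E - adjoint A (A E)"
    using lin by (simp add: V_def E_def linear_diff)
  then have "D \<bullet> (V - Z) = D \<bullet> E - A D \<bullet> A E"
    using lin by (simp add: inner_diff_right adjoint_works)
  moreover have "(norm D)\<^sup>2 \<le> 2 * (D \<bullet> (V - Z))"
    using quasi_optimal_projection_error[OF T Z(1) order_refl, of V] by (simp add: D_def HV)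
  ultimately have main: "(norm D)\<^sup>2 \<le> 2 * (D \<bullet> E - A D \<bullet> A E)"
    by simp
  have "norm D \<le> 2 * \<delta> * norm E"
  proof (cases "D = 0")
    case False
    have "norm D * norm D \<le> norm D * (2 * \<delta> * norm E)"
      using main polar by (simp add: power2_eq_square algebra_simps)
    then show ?thesis
      using False by simp
  next
    \<comment> \<open>Here \<open>0 \<le> \<delta> * norm E\<close> is needed; the RIP supplies it on \<open>E\<close> itself.\<close>
    case True
    have "E \<in> rank_row_sparse (3 * k) (3 * s)"
      using comb[of 0 1] by simp
    then have "(1 - \<delta>) * (norm E)\<^sup>2 \<le> (1 + \<delta>) * (norm E)\<^sup>2"
      using rip by (meson RIP_def order_trans)
    then have "0 \<le> (\<delta> * norm E) * norm E"
      by (simp add: algebra_simps power2_eq_square)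
    then show ?thesis
      using True by (cases "E = 0") (auto simp: zero_le_mult_iff)
  qed
  then show "norm (T (H V) - Z) \<le> 2 * \<delta> * norm (X - Z)"
    by (simp add: D_def E_def)
qed

text \<open>
  The map \<open>B\<close> carries the error before a gradient step to the error after it. If its norm
  vanishes, the step is exact and every starting error is admissible.
\<close>

lemma gradient_step_radius:
  fixes A :: "real^'c^'r \<Rightarrow> real^'m"
  assumes lin: "linear A" and "0 \<le> \<mu>"
  defines "B \<equiv> \<lambda>Z. Z - adjoint A (A Z)"
  assumes radius: "onorm B \<noteq> 0 \<Longrightarrow> norm E \<le> \<mu> / (2 * onorm B)"
  shows "2 * norm (B E) \<le> \<mu>"
proof -
  have "linear B"
    unfolding B_def
    using linear_compose[OF lin adjoint_linear[OF lin]]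
    by (intro linear_compose_sub linear_id[unfolded id_def]) (simp add: o_def)
  then have bl: "bounded_linear B"
    by (simp add: linear_conv_bounded_linear)
  have le: "norm (B E) \<le> onorm B * norm E"
    by (rule onorm[OF bl])
  show ?thesis
  proof (cases "onorm B = 0")
    case True
    then show ?thesis
      using le \<open>0 \<le> \<mu>\<close> by simp
  next
    case False
    then have "0 < onorm B"
      using onorm_pos_le[OF bl] by simp
    then have "onorm B * norm E \<le> \<mu> / 2"
      using radius[OF False] by (simp add: field_simps)
    then show ?thesis
      using le by simp
  qed
qed

theorem corollary2p5:
  fixes A :: "real^'c^'r \<Rightarrow> real^'m"
    and y :: "real^'m"
    and k s :: nat
    and \<delta> :: real
    and Xstar :: "real^'c^'r"
    and H T :: "real^'c^'r \<Rightarrow> real^'c^'r"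
    and X :: "nat \<Rightarrow> real^'c^'r"
  assumes "0 < k" and "k < s"
    and "linear A"
    and "RIP A \<delta> (rank_row_sparse (3 * k) (3 * s))" and "\<delta> < 0.5"
    and "{Z \<in> rank_row_sparse k s. A Z = y} = {Xstar}"
    and "card (nonzero_rows Xstar) = s"
    and "row_hard_thresholding s H"
    and "best_rank_approximation k T"
    and "X 0 \<in> rank_row_sparse k s"
    \<comment> \<open>for vanishing operator norm the radius is infinite, hence no constraint\<close>
    and "onorm (\<lambda>Z. Z - adjoint A (A Z)) \<noteq> 0 \<Longrightarrow>
      norm (X 0 - Xstar)
        \<le> min_nonzero_row_norm Xstar / (2 * onorm (\<lambda>Z. Z - adjoint A (A Z)))"
    and "\<And>l. X (Suc l) = (T \<circ> H) (X l - adjoint A (A (X l) - y))"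
  shows "\<forall>l. norm (X (Suc l) - Xstar) \<le> 2 * \<delta> * norm (X l - Xstar)"
proof -
  let ?B = "\<lambda>Z. Z - adjoint A (A Z)" and ?\<mu> = "min_nonzero_row_norm Xstar"
  have rank: "rank Xstar \<le> k" and y: "A Xstar = y"
    using assms(6) by (auto simp: rank_row_sparse_def)
  have "Xstar \<noteq> 0"
    using assms(2,7) by (auto simp: nonzero_rows_empty_iff[symmetric])
  then have \<mu>: "0 \<le> ?\<mu>"
    using min_nonzero_row_norm_pos by (metis less_imp_le)
  have step: "X (Suc l) \<in> rank_row_sparse k s"
      "norm (X (Suc l) - Xstar) \<le> 2 * \<delta> * norm (X l - Xstar)"
    if mem: "X l \<in> rank_row_sparse k s"
      and radius: "onorm ?B \<noteq> 0 \<Longrightarrow> norm (X l - Xstar) \<le> ?\<mu> / (2 * onorm ?B)" for l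
  proof -
    let ?V = "X l - adjoint A (A (X l) - A Xstar)"
    have "?V - Xstar = ?B (X l - Xstar)"
      using assms(3) by (simp add: linear_diff)
    moreover have "2 * norm (?B (X l - Xstar)) \<le> ?\<mu>"
      by (rule gradient_step_radius[OF assms(3) \<mu>]) (rule radius)
    ultimately have near: "2 * norm (?V - Xstar) \<le> ?\<mu>"
      by (simp only:)
    note contraction = iterative_hard_thresholding_step
      [OF assms(3,4) rank assms(7,8,9) mem near]
    show "X (Suc l) \<in> rank_row_sparse k s"
      "norm (X (Suc l) - Xstar) \<le> 2 * \<delta> * norm (X l - Xstar)"
      using contraction by (simp_all add: assms(12) y)
  qed
  have inv: "X l \<in> rank_row_sparse k s \<and>
      (onorm ?B \<noteq> 0 \<longrightarrow> norm (X l - Xstar) \<le> ?\<mu> / (2 * onorm ?B))" for l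
  proof (induction l)
    case 0
    then show ?case
      using assms(10,11) by blast
  next
    case (Suc l)
    then have "norm (X (Suc l) - Xstar) \<le> 2 * \<delta> * norm (X l - Xstar)"
      and mem: "X (Suc l) \<in> rank_row_sparse k s"
      using step by blast+
    moreover have "2 * \<delta> * norm (X l - Xstar) \<le> norm (X l - Xstar)"
      using mult_right_mono[of "2 * \<delta>" 1 "norm (X l - Xstar)"] assms(5) by simp
    ultimately show ?case
      using Suc by (meson order_trans)
  qed
  then show ?thesis
    using step by blast
qed

end
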